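(* Let $\mathbf A$ be an $\mathcal I$-zroupoid of type 1. Then $\mathbf A$ satisfies each of the identities (A1)–(A14): (A1) $x \to (y \to z) \approx (x \to y) \to z$; (A2) $x \to (y \to z) \approx x \to (z \to y)$; (A3) $x \to (y \to z) \approx (x \to z) \to y$; (A4) $x \to (y \to z) \approx y \to (x \to z)$; (A5) $x \to (y \to z) \approx (y \to x) \to z$; (A6) $x \to (y \to z) \approx y \to (z \to x)$; (A7) $x \to (y \to z) \approx (y \to z) \to x$; (A8) $x \to (y \to z) \approx (z \to x) \to y$; (A9) $x \to (y \to z) \approx z \to (y \to x)$; (A10) $x \to (y \to z) \approx (z \to y) \to x$; (A11) $(x \to y) \to z \approx (x \to z) \to y$; (A12) $(x \to y) \to z \approx (y \to x) \to z$; (A13) $(x \to y) \to z \approx (y \to z) \to x$; (A14) $(x \to y) \to z \approx (z \to y) \to x$.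
   Context: An $\mathcal I$-zroupoid is an algebra $\langle A,\to,0\rangle$ ($\to$ binary, $0$ constant) satisfying $(x \to y) \to z \approx [(z' \to x) \to (y \to z)']'$ and $0''\approx 0$, where $x' := x \to 0$ (prime binds tighter than $\to$). An $\mathcal I$-zroupoid $\mathbf A$ is of type 1 if it satisfies: (E1) $(x \to y)' \approx x \to (0 \to y)$; (E2) $x' \to y \approx x \to y'$; (E3) $0 \to (x \to y) \approx 0 \to (y \to x)$; (E4) $x \to (y \to z) \approx (p(x) \to p(y)) \to p(z)$, where $p$ is some (fixed) permutation of the variables $\{x,y,z\}$. *)

theory Defs
  imports Main
begin

locale zroupoid =
  fixes imp :: "'a \<Rightarrow> 'a \<Rightarrow> 'a"  (infix "\<rightarrow>" 65)
    and zero :: 'a  ("\<zero>")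
begin

abbreviation prime :: "'a \<Rightarrow> 'a"  ("_\<acute>" [1000] 1000)
  where "x\<acute> \<equiv> x \<rightarrow> \<zero>"

end

locale I_zroupoid = zroupoid +
  assumes I_identity: "(x \<rightarrow> y) \<rightarrow> z = ((z\<acute> \<rightarrow> x) \<rightarrow> (y \<rightarrow> z)\<acute>)\<acute>"
    and zero_prime_prime: "\<zero>\<acute>\<acute> = \<zero>"

text \<open>The variables permuted in identity (E4). An identity holds when it holds under
  every assignment \<open>v\<close> of elements of the algebra to the variables.\<close>

datatype var = X | Y | Z

locale type1_I_zroupoid = I_zroupoid +
  assumes E1: "(x \<rightarrow> y)\<acute> = x \<rightarrow> (\<zero> \<rightarrow> y)"
    and E2: "x\<acute> \<rightarrow> y = x \<rightarrow> y\<acute>"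
    and E3: "\<zero> \<rightarrow> (x \<rightarrow> y) = \<zero> \<rightarrow> (y \<rightarrow> x)"
    and E4: "\<exists>p :: var \<Rightarrow> var. bij p \<and>
      (\<forall>v :: var \<Rightarrow> 'a. v X \<rightarrow> (v Y \<rightarrow> v Z) = (v (p X) \<rightarrow> v (p Y)) \<rightarrow> v (p Z))"

end

(* Together with the other axioms, every permutation in (E4) gives (A2) and (A7): x(yz) does not depend on the
   order of y and z, nor on which side x stands. Given these, the prime can be moved freely
   through a product, triple products are fixed by the double prime, and the defining identity of
   I-zroupoids turns into the distributive law z(xy) = ((zx)(zy))'. Its instance y = 0 is the
   absorption law z(zx) = (zx)'. Distributing twice with q = zx and then absorbing twice,
   z(xy) = (q(zy))' = ((qz)(qy))'' = (q'(qy))'' = qy = y(zx), which is full symmetry. *)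

theory Submission
  imports Defs
begin

context type1_I_zroupoid
begin

text \<open>\<open>p\<close> is chosen once for the whole algebra, so each of its six possible
  values yields an identity valid for all elements.\<close>

lemma E4_cases:
  obtains
    "\<And>x y z. x \<rightarrow> (y \<rightarrow> z) = (x \<rightarrow> y) \<rightarrow> z"
  | "\<And>x y z. x \<rightarrow> (y \<rightarrow> z) = (x \<rightarrow> z) \<rightarrow> y"
  | "\<And>x y z. x \<rightarrow> (y \<rightarrow> z) = (y \<rightarrow> x) \<rightarrow> z"
  | "\<And>x y z. x \<rightarrow> (y \<rightarrow> z) = (y \<rightarrow> z) \<rightarrow> x"
  | "\<And>x y z. x \<rightarrow> (y \<rightarrow> z) = (z \<rightarrow> x) \<rightarrow> y"
  | "\<And>x y z. x \<rightarrow> (y \<rightarrow> z) = (z \<rightarrow> y) \<rightarrow> x"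
proof -
  obtain p :: "var \<Rightarrow> var" where p: "bij p"
    and E4_p: "v X \<rightarrow> (v Y \<rightarrow> v Z) = (v (p X) \<rightarrow> v (p Y)) \<rightarrow> v (p Z)" for v :: "var \<Rightarrow> 'a"
    using E4 by blast
  \<comment> \<open>\<open>case_var x y z\<close> is the assignment sending \<open>X\<close>,
    \<open>Y\<close>, \<open>Z\<close> to \<open>x\<close>, \<open>y\<close>,
    \<open>z\<close>.\<close>
  have eq: "x \<rightarrow> (y \<rightarrow> z) = (case_var x y z (p X) \<rightarrow> case_var x y z (p Y)) \<rightarrow> case_var x y z (p Z)"
    for x y z
    using E4_p[of "case_var x y z"] by simp
  have "p X \<noteq> p Y" "p X \<noteq> p Z" "p Y \<noteq> p Z"
    using p by (auto dest: bij_is_inj injD)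
  then consider
      "p X = X" "p Y = Y" "p Z = Z"
    | "p X = X" "p Y = Z" "p Z = Y"
    | "p X = Y" "p Y = X" "p Z = Z"
    | "p X = Y" "p Y = Z" "p Z = X"
    | "p X = Z" "p Y = X" "p Z = Y"
    | "p X = Z" "p Y = Y" "p Z = X"
    by (cases "p X"; cases "p Y"; cases "p Z") auto
  then show thesis
    using eq by cases (auto intro: that)
qed

text \<open>\<open>E3\<close> is the case of left factor 0. By \<open>I_identity\<close> and
  \<open>E1\<close>, (xy)z = (z'x)(0(yz)'), whose right factor starts with 0 and so is open to
  \<open>E3\<close>.\<close>

lemma right_commute: "x \<rightarrow> (y \<rightarrow> z) = x \<rightarrow> (z \<rightarrow> y)"
proof (rule E4_cases)
  assume "\<And>x y z. x \<rightarrow> (y \<rightarrow> z) = (x \<rightarrow> y) \<rightarrow> z"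
  then show "x \<rightarrow> (y \<rightarrow> z) = x \<rightarrow> (z \<rightarrow> y)"
    by (metis E1 E2 E3 I_identity zero_prime_prime)
next
  \<comment> \<open>This case contains \<open>E1\<close> (put y = 0) and \<open>E2\<close> (put z =
    0).\<close>
  assume "\<And>x y z. x \<rightarrow> (y \<rightarrow> z) = (x \<rightarrow> z) \<rightarrow> y"
  then show "x \<rightarrow> (y \<rightarrow> z) = x \<rightarrow> (z \<rightarrow> y)"
    by (metis E3 I_identity zero_prime_prime)
next
  assume "\<And>x y z. x \<rightarrow> (y \<rightarrow> z) = (y \<rightarrow> x) \<rightarrow> z"
  then show "x \<rightarrow> (y \<rightarrow> z) = x \<rightarrow> (z \<rightarrow> y)"
    by (metis E1 E2 E3 I_identity zero_prime_prime)
next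
  assume "\<And>x y z. x \<rightarrow> (y \<rightarrow> z) = (y \<rightarrow> z) \<rightarrow> x"
  then show "x \<rightarrow> (y \<rightarrow> z) = x \<rightarrow> (z \<rightarrow> y)"
    by (metis E1 E2 E3 I_identity zero_prime_prime)
next
  assume "\<And>x y z. x \<rightarrow> (y \<rightarrow> z) = (z \<rightarrow> x) \<rightarrow> y"
  then show "x \<rightarrow> (y \<rightarrow> z) = x \<rightarrow> (z \<rightarrow> y)"
    by (metis E1 E2 E3 I_identity zero_prime_prime)
next
  assume "\<And>x y z. x \<rightarrow> (y \<rightarrow> z) = (z \<rightarrow> y) \<rightarrow> x"
  then show "x \<rightarrow> (y \<rightarrow> z) = x \<rightarrow> (z \<rightarrow> y)"
    by (metis E1 E2 E3 I_identity zero_prime_prime)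
qed

text \<open>Modulo \<open>right_commute\<close> the six cases pair up: first with second, third with
  fifth, fourth with sixth. The last pair is the claim.\<close>

lemma triple_commute: "x \<rightarrow> (y \<rightarrow> z) = (y \<rightarrow> z) \<rightarrow> x"
proof (rule E4_cases)
  assume "\<And>x y z. x \<rightarrow> (y \<rightarrow> z) = (x \<rightarrow> y) \<rightarrow> z"
  then show "x \<rightarrow> (y \<rightarrow> z) = (y \<rightarrow> z) \<rightarrow> x"
    by (metis right_commute E2 E3 I_identity zero_prime_prime)
next
  assume "\<And>x y z. x \<rightarrow> (y \<rightarrow> z) = (x \<rightarrow> z) \<rightarrow> y"
  then show "x \<rightarrow> (y \<rightarrow> z) = (y \<rightarrow> z) \<rightarrow> x"
    by (metis right_commute E3 I_identity zero_prime_prime)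
next
  assume "\<And>x y z. x \<rightarrow> (y \<rightarrow> z) = (y \<rightarrow> x) \<rightarrow> z"
  then show "x \<rightarrow> (y \<rightarrow> z) = (y \<rightarrow> z) \<rightarrow> x"
    by (metis right_commute E1 E2 E3 I_identity zero_prime_prime)
next
  assume "\<And>x y z. x \<rightarrow> (y \<rightarrow> z) = (y \<rightarrow> z) \<rightarrow> x"
  then show "x \<rightarrow> (y \<rightarrow> z) = (y \<rightarrow> z) \<rightarrow> x"
    by simp
next
  assume "\<And>x y z. x \<rightarrow> (y \<rightarrow> z) = (z \<rightarrow> x) \<rightarrow> y"
  then show "x \<rightarrow> (y \<rightarrow> z) = (y \<rightarrow> z) \<rightarrow> x"
    by (metis right_commute E1 E2 E3 I_identity zero_prime_prime)
next
  assume "\<And>x y z. x \<rightarrow> (y \<rightarrow> z) = (z \<rightarrow> y) \<rightarrow> x"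
  then show "x \<rightarrow> (y \<rightarrow> z) = (y \<rightarrow> z) \<rightarrow> x"
    by (metis right_commute)
qed

text \<open>\<open>E2\<close> shifts two of the primes onto 0, where they cancel.\<close>

lemma triple_prime: "v\<acute>\<acute>\<acute> = v\<acute>"
  by (metis E2 zero_prime_prime)

text \<open>\<open>I_identity\<close> exhibits every triple product as a prime, and primes are fixed
  by the double prime.\<close>

lemma double_prime_triple: "(x \<rightarrow> (y \<rightarrow> z))\<acute>\<acute> = x \<rightarrow> (y \<rightarrow> z)"
  by (metis triple_commute I_identity triple_prime)

lemma imp_prime_right: "x \<rightarrow> y\<acute> = (x \<rightarrow> y)\<acute>"
  by (metis right_commute E1)

lemma imp_prime_left: "x\<acute> \<rightarrow> y = (x \<rightarrow> y)\<acute>"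
  by (metis imp_prime_right E2)

text \<open>Once pulled to the outside, the three primes of \<open>I_identity\<close> collapse to
  one.\<close>

lemma distrib_prime: "z \<rightarrow> (x \<rightarrow> y) = ((z \<rightarrow> x) \<rightarrow> (z \<rightarrow> y))\<acute>"
  by (metis right_commute triple_commute I_identity imp_prime_left imp_prime_right triple_prime)

lemma absorb: "z \<rightarrow> (z \<rightarrow> x) = (z \<rightarrow> x)\<acute>"
proof -
  have "(z \<rightarrow> x)\<acute> = ((z \<rightarrow> x) \<rightarrow> z\<acute>)\<acute>"
    using distrib_prime[of z x \<zero>] by (simp only: imp_prime_right)
  also have "\<dots> = (z \<rightarrow> (z \<rightarrow> x))\<acute>\<acute>"
    by (simp only: imp_prime_right triple_commute[of z])
  finally show ?thesis
    by (simp only: double_prime_triple)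
qed

lemma left_commute: "x \<rightarrow> (y \<rightarrow> z) = y \<rightarrow> (x \<rightarrow> z)"
proof -
  define q where "q = x \<rightarrow> z"
  have "x \<rightarrow> (y \<rightarrow> z) = (q \<rightarrow> (x \<rightarrow> y))\<acute>"
    by (metis distrib_prime right_commute q_def)
  also have "\<dots> = ((q \<rightarrow> x) \<rightarrow> (q \<rightarrow> y))\<acute>\<acute>"
    by (simp only: distrib_prime[of q])
  \<comment> \<open>(xz)x = x(xz), which absorbs to (xz)'.\<close>
  also have "q \<rightarrow> x = q\<acute>"
    by (metis absorb triple_commute q_def)
  also have "(q\<acute> \<rightarrow> (q \<rightarrow> y))\<acute>\<acute> = (q \<rightarrow> y)\<acute>\<acute>\<acute>\<acute>"
    by (simp only: imp_prime_left[of q "q \<rightarrow> y"] absorb)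
  \<comment> \<open>qy = y(xz) is a triple product, so the four primes cancel in pairs.\<close>
  also have "\<dots> = y \<rightarrow> (x \<rightarrow> z)"
    by (metis double_prime_triple triple_commute q_def)
  finally show ?thesis .
qed

lemma assoc: "x \<rightarrow> (y \<rightarrow> z) = (x \<rightarrow> y) \<rightarrow> z"
  by (metis right_commute triple_commute left_commute)

end

theorem theorem3p7:
  fixes imp :: "'a \<Rightarrow> 'a \<Rightarrow> 'a"  (infix "\<rightarrow>" 65)
    and zero :: 'a  ("\<zero>")
  assumes "type1_I_zroupoid (\<rightarrow>) \<zero>"
  shows "(\<forall>x y z. x \<rightarrow> (y \<rightarrow> z) = (x \<rightarrow> y) \<rightarrow> z) \<and>
    (\<forall>x y z. x \<rightarrow> (y \<rightarrow> z) = x \<rightarrow> (z \<rightarrow> y)) \<and>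
    (\<forall>x y z. x \<rightarrow> (y \<rightarrow> z) = (x \<rightarrow> z) \<rightarrow> y) \<and>
    (\<forall>x y z. x \<rightarrow> (y \<rightarrow> z) = y \<rightarrow> (x \<rightarrow> z)) \<and>
    (\<forall>x y z. x \<rightarrow> (y \<rightarrow> z) = (y \<rightarrow> x) \<rightarrow> z) \<and>
    (\<forall>x y z. x \<rightarrow> (y \<rightarrow> z) = y \<rightarrow> (z \<rightarrow> x)) \<and>
    (\<forall>x y z. x \<rightarrow> (y \<rightarrow> z) = (y \<rightarrow> z) \<rightarrow> x) \<and>
    (\<forall>x y z. x \<rightarrow> (y \<rightarrow> z) = (z \<rightarrow> x) \<rightarrow> y) \<and>
    (\<forall>x y z. x \<rightarrow> (y \<rightarrow> z) = z \<rightarrow> (y \<rightarrow> x)) \<and>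
    (\<forall>x y z. x \<rightarrow> (y \<rightarrow> z) = (z \<rightarrow> y) \<rightarrow> x) \<and>
    (\<forall>x y z. (x \<rightarrow> y) \<rightarrow> z = (x \<rightarrow> z) \<rightarrow> y) \<and>
    (\<forall>x y z. (x \<rightarrow> y) \<rightarrow> z = (y \<rightarrow> x) \<rightarrow> z) \<and>
    (\<forall>x y z. (x \<rightarrow> y) \<rightarrow> z = (y \<rightarrow> z) \<rightarrow> x) \<and>
    (\<forall>x y z. (x \<rightarrow> y) \<rightarrow> z = (z \<rightarrow> y) \<rightarrow> x)"
proof -
  interpret type1_I_zroupoid imp zero
    by (fact assms)
  show ?thesis
    \<comment> \<open>\<open>assoc\<close> brackets everything to the right; the two commutation
      laws then generate all permutations of the factors.\<close>
    by (intro conjI allI; metis right_commute left_commute assoc)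
qed

end
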